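(* Let $\Theta\subset\mathbb R^p$ be compact, convex, and contained in a closed Euclidean ball of radius $r>0$. Assume $\boldsymbol\Psi:\Theta\to\mathbb S^m_{++}$ satisfies $\|\boldsymbol\Psi(\boldsymbol\theta)-\boldsymbol\Psi(\boldsymbol\theta')\|_2\le L_\Psi\|\boldsymbol\theta-\boldsymbol\theta'\|_2$ and $\alpha\mathbf I\preceq\boldsymbol\Psi(\boldsymbol\theta)\preceq\beta\mathbf I$ for all $\boldsymbol\theta,\boldsymbol\theta'\in\Theta$ ($0<\alpha\le\beta$), and that $\boldsymbol\theta\mapsto\mathbf A(\boldsymbol\theta)\boldsymbol\mu_{\mathbf x}$, $\boldsymbol\theta\mapsto\boldsymbol\Psi(\boldsymbol\theta)$ and $\boldsymbol\theta\mapsto\log\pi_{\boldsymbol\theta}(\boldsymbol\theta)$ are continuously differentiable with Lipschitz continuous gradients on $\Theta$ (and $\mathcal F$ is continuously differentiable on an open neighborhood of $\Theta$). Let $(\varepsilon_t)_{t\ge0}$, $(\delta_t)_{t\ge0}$ be positive sequences with $\sum_t\varepsilon_t<\infty$ and $\sum_t\delta_t=\delta<1$, and set $\gamma_t=\max\{(12rmL_\Psi/(\varepsilon_t\alpha))^p,1\}$, $\varsigma_F=\frac1\alpha\max_{\boldsymbol\theta\in\Theta}\|\boldsymbol\Psi(\boldsymbol\theta)\|_F$, $\varsigma_2=\frac1\alpha\max_{\boldsymbol\theta\in\Theta}\|\boldsymbol\Psi(\boldsymbol\theta)\|_2$. Consider the M$^3$C iterates $\widehat{\boldsymbol\theta}_{t+1}\in\arg\min_{\boldsymbol\theta\in\Theta}\widehat{\mathcal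 G}_{N_t}(\boldsymbol\theta\mid\widehat{\boldsymbol\theta}_t)$, where at iteration $t$ the estimator uses $N_t$ Rademacher vectors drawn independently of $\widehat{\boldsymbol\theta}_t$, with $$N_t\ge\frac{16(2\varsigma_F^2+\varepsilon_t\varsigma_2)}{\varepsilon_t^2}\ln\Big(\frac{2\gamma_t}{\delta_t}\Big).$$ Then, with probability at least $1-\delta$, every accumulation point of $(\widehat{\boldsymbol\theta}_t)_{t\ge0}$ is a first-order stationary point of $\mathcal F$ over $\Theta$, i.e. a point $\boldsymbol\theta^*$ with $\langle\nabla\mathcal F(\boldsymbol\theta^* ),\boldsymbol\theta-\boldsymbol\theta^*\rangle\ge0$ for all $\boldsymbol\theta\in\Theta$.
   Context: Given data $\mathbf b\in\mathbb R^m$, $\boldsymbol\mu_{\mathbf x}\in\mathbb R^n$, a map $\boldsymbol\theta\mapsto\mathbf A(\boldsymbol\theta)\in\mathbb R^{m\times n}$, SPD matrices $\mathbf Q_{\mathbf x}(\boldsymbol\theta)$, $\mathbf R(\boldsymbol\theta)$, and a positive hyperprior density $\pi_{\boldsymbol\theta}$, let $\boldsymbol\Psi(\boldsymbol\theta)=\mathbf A(\boldsymbol\theta)\mathbf Q_{\mathbf x}(\boldsymbol\theta)\mathbf A(\boldsymbol\theta)^\top+\mathbf R(\boldsymbol\theta)$ and $$\mathcal F(\boldsymbol\theta)=-\log\pi_{\boldsymbol\theta}(\boldsymbol\theta)+\tfrac12\log\det\boldsymbol\Psi(\boldsymbol\theta)+\tfrac12\|\mathbf A(\boldsymbol\theta)\boldsymbol\mu_{\mathbf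 x}-\mathbf b\|^2_{\boldsymbol\Psi(\boldsymbol\theta)^{-1}},\quad \|\mathbf v\|_{\mathbf K}^2=\mathbf v^\top\mathbf K\mathbf v.$$ MM surrogate: $\mathcal G(\boldsymbol\theta\mid\boldsymbol\theta')=-\log\pi_{\boldsymbol\theta}(\boldsymbol\theta)+\frac12[\log\det\boldsymbol\Psi(\boldsymbol\theta')-m+\mathrm{trace}(\boldsymbol\Psi(\boldsymbol\theta')^{-1}\boldsymbol\Psi(\boldsymbol\theta))]+\frac12\|\mathbf A(\boldsymbol\theta)\boldsymbol\mu_{\mathbf x}-\mathbf b\|^2_{\boldsymbol\Psi(\boldsymbol\theta)^{-1}}$. Monte Carlo surrogate (M$^3$C): with independent Rademacher vectors $\mathbf w_1,\dots,\mathbf w_N\in\{\pm1\}^m$ (i.i.d. uniform $\pm1$ entries) and $\mathbf z_i=\boldsymbol\Psi(\boldsymbol\theta')^{-1}\mathbf w_i$, $\widehat{\mathcal G}_N(\boldsymbol\theta\mid\boldsymbol\theta')$ is $\mathcal G(\boldsymbol\theta\mid\boldsymbol\theta')$ with $\mathrm{trace}(\boldsymbol\Psi(\boldsymbol\theta')^{-1}\boldsymbol\Psi(\boldsymbol\theta))$ replaced by $\frac1N\sum_{i=1}^N\mathbf z_i^\top\boldsymbol\Psi(\boldsymbol\theta)\mathbf w_i$ (constants independent of $\boldsymbol\theta$ do not affect the minimizer). $\|\cdot\|_F$ Frobenius norm, $\|\cdot\|_2$ spectral norm; $\mathbb S^m_{++}$ SPD $m\times m$ matrices. *)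

theory Defs
  imports "HOL-Probability.Probability"
begin

definition spd :: "real^'m^'m \<Rightarrow> bool" where
  "spd M \<longleftrightarrow> transpose M = M \<and> (\<forall>x. x \<noteq> 0 \<longrightarrow> x \<bullet> (M *v x) > 0)"

definition loewner_le :: "real^'m^'m \<Rightarrow> real^'m^'m \<Rightarrow> bool" where
  "loewner_le M N \<longleftrightarrow> (\<forall>x. x \<bullet> (M *v x) \<le> x \<bullet> (N *v x))"

definition spec_norm :: "real^'n^'m \<Rightarrow> real" where
  "spec_norm M = onorm (\<lambda>x. M *v x)"

definition frob_norm :: "real^'n^'m \<Rightarrow> real" where
  "frob_norm M = sqrt (\<Sum>i\<in>UNIV. \<Sum>j\<in>UNIV. (M $ i $ j)\<^sup>2)"

definition Psi :: "('p \<Rightarrow> real^'n^'m) \<Rightarrow> ('p \<Rightarrow> real^'n^'n) \<Rightarrow> ('p \<Rightarrow> real^'m^'m)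
    \<Rightarrow> 'p \<Rightarrow> real^'m^'m" where
  "Psi A Q R \<theta> = A \<theta> ** Q \<theta> ** transpose (A \<theta>) + R \<theta>"

definition wnorm2 :: "real^'m \<Rightarrow> real^'m^'m \<Rightarrow> real" where
  "wnorm2 v K = v \<bullet> (K *v v)"

definition Fobj :: "('p \<Rightarrow> real) \<Rightarrow> ('p \<Rightarrow> real^'n^'m) \<Rightarrow> ('p \<Rightarrow> real^'n^'n)
    \<Rightarrow> ('p \<Rightarrow> real^'m^'m) \<Rightarrow> real^'n \<Rightarrow> real^'m \<Rightarrow> 'p \<Rightarrow> real" where
  "Fobj pr A Q R mu b \<theta> =
     - ln (pr \<theta>) + 1/2 * ln (det (Psi A Q R \<theta>))
     + 1/2 * wnorm2 (A \<theta> *v mu - b) (matrix_inv (Psi A Q R \<theta>))"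

definition Ghat :: "('p \<Rightarrow> real) \<Rightarrow> ('p \<Rightarrow> real^'n^'m) \<Rightarrow> ('p \<Rightarrow> real^'n^'n)
    \<Rightarrow> ('p \<Rightarrow> real^'m^'m) \<Rightarrow> real^'n \<Rightarrow> real^'m \<Rightarrow> nat \<Rightarrow> (nat \<Rightarrow> real^'m)
    \<Rightarrow> 'p \<Rightarrow> 'p \<Rightarrow> real" where
  "Ghat pr A Q R mu b N w \<theta>' \<theta> =
     - ln (pr \<theta>)
     + 1/2 * (ln (det (Psi A Q R \<theta>')) - real CARD('m)
              + (1 / real N) * (\<Sum>i<N. (matrix_inv (Psi A Q R \<theta>') *v w i) \<bullet> (Psi A Q R \<theta> *v w i)))
     + 1/2 * wnorm2 (A \<theta> *v mu - b) (matrix_inv (Psi A Q R \<theta>))"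

end

theory Submission
  imports Defs
begin

text \<open>
  The stochastic trace estimate is linear in the empirical second moment matrix
  \<open>(1/N) \<Sum>i. w\<^sub>i w\<^sub>i\<^sup>T\<close> of the probe vectors. Off the diagonal its entries are averages of
  independent signs, and on the diagonal they equal 1 almost surely. Hoeffding's inequality and the
  Borel--Cantelli lemma therefore show that, almost surely, the estimation error at iteration \<open>t\<close>
  is eventually at most a constant times \<open>\<epsilon>\<^sub>t\<close>, simultaneously in both arguments of the surrogate.

  Simultaneous diagonalization of \<open>P\<close> and \<open>X\<close> reduces
  \<open>ln det X \<le> ln det P + trace (P\<^sup>-\<^sup>1 X) - m\<close> to \<open>ln x \<le> x - 1\<close>. Applied also with \<open>P\<close> and
  \<open>X\<close> exchanged, it shows that the surrogate exceeds the objective by at most a multiple of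
  \<open>\<parallel>X - P\<parallel>\<^sup>2\<close>. The iterates thus satisfy
  \<open>F(\<theta>\<^sub>t\<^sub>+\<^sub>1) \<le> F(\<theta>) + C \<parallel>\<theta> - \<theta>\<^sub>t\<parallel>\<^sup>2 + e\<^sub>t\<close> for every feasible \<open>\<theta>\<close>, with summable \<open>e\<^sub>t\<close>.
  Hence \<open>F(\<theta>\<^sub>t)\<close> converges, and in the limit an accumulation point \<open>z\<close> satisfies
  \<open>F(z) \<le> F(\<theta>) + C \<parallel>\<theta> - z\<parallel>\<^sup>2\<close>, which forces first-order stationarity.
\<close>

section \<open>Log-determinant and trace\<close>

lemma symmetric_inner_commute:
  fixes M :: "real^'n^'n"
  assumes "transpose M = M"
  shows "x \<bullet> (M *v y) = y \<bullet> (M *v x)"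
  by (metis assms dot_lmul_matrix inner_commute vector_transpose_matrix)

text \<open>Generalized eigenvectors of \<open>X\<close> relative to \<open>P\<close> are chosen one
  index at a time, each maximizing the form of \<open>X\<close> among the P-unit vectors that are
  P-orthogonal to the earlier ones. The third conjunct carries the induction: it makes each new
  vector X-orthogonal to the old ones.\<close>

lemma simultaneous_orthogonal_family:
  fixes P X :: "real^'m^'m" and I :: "'m set"
  assumes sym: "transpose P = P" "transpose X = X"
    and pos: "0 < \<alpha>" "\<And>x. \<alpha> * (x \<bullet> x) \<le> x \<bullet> (P *v x)"
  shows "\<exists>v :: 'm \<Rightarrow> real^'m.
    (\<forall>i\<in>I. v i \<bullet> (P *v v i) = 1) \<and>
    (\<forall>i\<in>I. \<forall>j\<in>I. i \<noteq> j \<longrightarrow> v i \<bullet> (P *v v j) = 0 \<and> v i \<bullet> (X *v v j) = 0) \<and>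
    (\<forall>u. (\<forall>i\<in>I. v i \<bullet> (P *v u) = 0) \<longrightarrow> (\<forall>i\<in>I. v i \<bullet> (X *v u) = 0))"
proof (induction I rule: finite_induct[OF finite])
  case 1
  then show ?case by simp
next
  case (2 k I)
  from 2(3) obtain v :: "'m \<Rightarrow> real^'m"
    where v: "(\<forall>i\<in>I. v i \<bullet> (P *v v i) = 1) \<and>
    (\<forall>i\<in>I. \<forall>j\<in>I. i \<noteq> j \<longrightarrow> v i \<bullet> (P *v v j) = 0 \<and> v i \<bullet> (X *v v j) = 0) \<and>
    (\<forall>u. (\<forall>i\<in>I. v i \<bullet> (P *v u) = 0) \<longrightarrow> (\<forall>i\<in>I. v i \<bullet> (X *v u) = 0))"
    by (rule exE)
  have v1: "v i \<bullet> (P *v v i) = 1" if "i \<in> I" for i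
    using v that by simp
  have v2: "v i \<bullet> (P *v v j) = 0 \<and> v i \<bullet> (X *v v j) = 0" if "i \<in> I" "j \<in> I" "i \<noteq> j" for i j
    using v that by simp
  have v3: "v i \<bullet> (X *v u) = 0" if "\<forall>i\<in>I. v i \<bullet> (P *v u) = 0" "i \<in> I" for u i
    using v that by simp
  have Pcomm: "x \<bullet> (P *v y) = y \<bullet> (P *v x)" and Xcomm: "x \<bullet> (X *v y) = y \<bullet> (X *v x)" for x y
    using sym by (auto intro: symmetric_inner_commute)
  have Ppos: "0 < x \<bullet> (P *v x)" if "x \<noteq> 0" for x
    using pos(2)[of x] pos(1) that by (meson inner_gt_zero_iff less_le_trans mult_pos_pos)
  define S where "S = {u. \<forall>i\<in>I. v i \<bullet> (P *v u) = 0}"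
  have Slin: "s *\<^sub>R x + t *\<^sub>R y \<in> S" if "x \<in> S" "y \<in> S" for s t x y
    using that by (simp add: S_def matrix_vector_right_distrib matrix_vector_mult_scaleR
        inner_right_distrib)
  \<comment> \<open>The P-unit vectors of the P-orthogonal complement \<open>S\<close>. Coercivity
    of \<open>P\<close> bounds this set, so the form of \<open>X\<close> attains a maximum on
    it.\<close>
  define C where "C = S \<inter> {u. u \<bullet> (P *v u) = 1}"
  have "closed C"
  proof -
    have "S = (\<Inter>i\<in>I. {u. v i \<bullet> (P *v u) = 0})"
      by (auto simp: S_def)
    moreover have "closed {u. v i \<bullet> (P *v u) = 0}" for i
      by (intro closed_Collect_eq continuous_intros linear_continuous_on matrix_vector_mul_bounded_linear)
    moreover have "closed {u. u \<bullet> (P *v u) = 1}"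
      by (intro closed_Collect_eq continuous_intros linear_continuous_on matrix_vector_mul_bounded_linear)
    ultimately show ?thesis
      by (auto simp: C_def)
  qed
  moreover have "bounded C"
  proof (rule boundedI)
    fix x assume "x \<in> C"
    then have "\<alpha> * (norm x)\<^sup>2 \<le> 1"
      using pos(2)[of x] by (simp add: C_def power2_norm_eq_inner)
    then have "(norm x)\<^sup>2 \<le> 1 / \<alpha>"
      using pos(1) by (simp add: field_simps)
    then show "norm x \<le> sqrt (1 / \<alpha>)"
      by (simp add: real_le_rsqrt)
  qed
  ultimately have "compact C"
    by (simp add: compact_eq_bounded_closed)
  moreover have "C \<noteq> {}"
  proof -
    \<comment> \<open>Since \<open>k\<close> is not in \<open>I\<close>, there are fewer than m
      vectors \<open>P *v v i\<close>, so some nonzero \<open>a\<close> is orthogonal to all of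
      them; symmetry of \<open>P\<close> puts \<open>a\<close> into \<open>S\<close>.\<close>
    have "dim ((\<lambda>i. P *v v i) ` I) \<le> card ((\<lambda>i. P *v v i) ` I)"
      by (simp add: dim_le_card')
    also have "\<dots> \<le> card I"
      by (simp add: card_image_le)
    also have "\<dots> < CARD('m)"
      using 2(2) by (intro psubset_card_mono) auto
    finally obtain a where a: "a \<noteq> 0" "span ((\<lambda>i. P *v v i) ` I) \<subseteq> {x. a \<bullet> x = 0}"
      using lowdim_subset_hyperplane[of "(\<lambda>i. P *v v i) ` I"] by auto
    then have "a \<bullet> (P *v v i) = 0" if "i \<in> I" for i
      using that span_base[of "P *v v i" "(\<lambda>i. P *v v i) ` I"] by auto
    then have "a \<in> S"
      using Pcomm by (simp add: S_def)
    define q where "q = a \<bullet> (P *v a)"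
    have "q > 0"
      using Ppos a(1) by (simp add: q_def)
    have "(1 / sqrt q) *\<^sub>R a \<in> C"
      using \<open>a \<in> S\<close> \<open>q > 0\<close> Slin[of a a "1 / sqrt q" 0]
      by (simp add: C_def matrix_vector_mult_scaleR flip: q_def)
    then show ?thesis by blast
  qed
  moreover have "continuous_on C (\<lambda>u. u \<bullet> (X *v u))"
    by (intro continuous_intros linear_continuous_on matrix_vector_mul_bounded_linear)
  ultimately have "\<exists>w\<in>C. \<forall>u\<in>C. u \<bullet> (X *v u) \<le> w \<bullet> (X *v w)"
    by (rule continuous_attains_sup)
  then obtain w where w: "w \<in> C" "\<And>u. u \<in> C \<Longrightarrow> u \<bullet> (X *v u) \<le> w \<bullet> (X *v w)"
    by (elim bexE) simp
  define l where "l = w \<bullet> (X *v w)"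
  have wS: "w \<in> S" and w1: "w \<bullet> (P *v w) = 1"
    using w by (auto simp: C_def)
  \<comment> \<open>Both forms are homogeneous of degree 2, so rescaling carries the maximality of
    \<open>l\<close> from \<open>C\<close> to all of \<open>S\<close>.\<close>
  have hom: "u \<bullet> (X *v u) \<le> l * (u \<bullet> (P *v u))" if "u \<in> S" for u
  proof (cases "u = 0")
    case False
    define q where "q = u \<bullet> (P *v u)"
    have "q > 0"
      using Ppos False by (simp add: q_def)
    have "(1 / sqrt q) *\<^sub>R u \<in> C"
      using that \<open>q > 0\<close> Slin[of u u "1 / sqrt q" 0]
      by (simp add: C_def matrix_vector_mult_scaleR flip: q_def)
    then have "(u \<bullet> (X *v u)) / q \<le> l"
      using w(2)[of "(1 / sqrt q) *\<^sub>R u"] \<open>q > 0\<close> by (simp add: matrix_vector_mult_scaleR l_def)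
    then show ?thesis
      using \<open>q > 0\<close> by (simp add: field_simps q_def)
  qed simp
  \<comment> \<open>First-order optimality of \<open>w\<close>: a nonzero cross term
    \<open>c\<close> would push the X-form of \<open>w + t u\<close> above \<open>l\<close> times
    its P-form for small \<open>t\<close> of the sign of \<open>c\<close>.\<close>
  have orth: "w \<bullet> (X *v u) = 0" if "u \<in> S" "w \<bullet> (P *v u) = 0" for u
  proof (rule ccontr)
    define c where "c = w \<bullet> (X *v u)"
    \<comment> \<open>An upper bound for the second-order coefficient. The added 1 makes it strictly
      positive, so that \<open>t = c / d\<close> can be inserted below, where the linear term beats
      the quadratic one.\<close>
    define d where "d = \<bar>l * (u \<bullet> (P *v u)) - u \<bullet> (X *v u)\<bar> + 1"
    assume "w \<bullet> (X *v u) \<noteq> 0"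
    then have "c \<noteq> 0" by (simp add: c_def)
    have d: "d > 0" "l * (u \<bullet> (P *v u)) - u \<bullet> (X *v u) \<le> d"
      by (auto simp: d_def)
    have quad: "2 * t * c \<le> t\<^sup>2 * d" for t
    proof -
      have "(w + t *\<^sub>R u) \<bullet> (X *v (w + t *\<^sub>R u)) \<le> l * ((w + t *\<^sub>R u) \<bullet> (P *v (w + t *\<^sub>R u)))"
        using hom Slin[OF wS that(1), of 1 t] by simp
      moreover have "u \<bullet> (X *v w) = c" "u \<bullet> (P *v w) = 0"
        using Xcomm Pcomm that c_def by auto
      ultimately have "l + 2 * t * c + t\<^sup>2 * (u \<bullet> (X *v u)) \<le> l * (1 + t\<^sup>2 * (u \<bullet> (P *v u)))"
        using that(2) w1 by (simp add: matrix_vector_right_distrib matrix_vector_mult_scaleR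
            inner_left_distrib inner_right_distrib power2_eq_square algebra_simps
            flip: l_def c_def)
      then have "2 * t * c \<le> t\<^sup>2 * (l * (u \<bullet> (P *v u)) - u \<bullet> (X *v u))"
        by (simp add: algebra_simps)
      also have "\<dots> \<le> t\<^sup>2 * d"
        using d by (intro mult_left_mono) auto
      finally show ?thesis .
    qed
    have "2 * c\<^sup>2 / d \<le> c\<^sup>2 / d"
      using quad[of "c / d"] d by (simp add: power2_eq_square field_simps)
    moreover have "c\<^sup>2 / d > 0"
      using \<open>c \<noteq> 0\<close> d by simp
    ultimately show False by simp
  qed
  have ne: "i \<noteq> k" if "i \<in> I" for i
    using that 2 by blast
  have wP: "v i \<bullet> (P *v w) = 0" "w \<bullet> (P *v v i) = 0" if "i \<in> I" for i
    using wS that Pcomm[of w] by (auto simp: S_def)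
  have wX: "v i \<bullet> (X *v w) = 0" "w \<bullet> (X *v v i) = 0" if "i \<in> I" for i
    using v3[of w i] that wP Xcomm[of w] by auto
  show ?case
  proof (rule exI[of _ "v(k := w)"], intro conjI ballI allI impI)
    fix u i assume u: "\<forall>i\<in>insert k I. (v(k := w)) i \<bullet> (P *v u) = 0" and i: "i \<in> insert k I"
    have "v j \<bullet> (P *v u) = 0" if "j \<in> I" for j
      using u that ne[OF that] by auto
    then show "(v(k := w)) i \<bullet> (X *v u) = 0"
      using i ne orth[of u] v3[of u] u by (auto simp: S_def)
  qed (use v1 v2 w1 wP wX ne in auto)
qed

lemma entry_congruence:
  fixes V M :: "real^'m^'m"
  shows "(transpose V ** M ** V) $ i $ j = column i V \<bullet> (M *v column j V)"
proof -
  have "(transpose V ** M ** V) $ i $ j = (\<Sum>b\<in>UNIV. \<Sum>a\<in>UNIV. V $ a $ i * M $ a $ b * V $ b $ j)"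
    by (simp add: matrix_matrix_mult_def transpose_def sum_distrib_right)
  also have "\<dots> = (\<Sum>a\<in>UNIV. \<Sum>b\<in>UNIV. V $ a $ i * M $ a $ b * V $ b $ j)"
    by (rule sum.swap)
  finally show ?thesis
    by (simp add: inner_vec_def matrix_vector_mult_def column_def sum_distrib_left mult.assoc)
qed

text \<open>Coercivity makes the kernel trivial, so a two-sided inverse exists and the choice in
  \<open>matrix_inv\<close> yields one.\<close>

lemma matrix_inv_left_right:
  fixes P :: "real^'m^'m"
  assumes "0 < \<alpha>" "\<And>x. \<alpha> * (x \<bullet> x) \<le> x \<bullet> (P *v x)"
  shows "matrix_inv P ** P = mat 1" "P ** matrix_inv P = mat 1"
proof -
  have "x = 0" if "P *v x = 0" for x
    using assms(2)[of x] assms(1) that inner_gt_zero_iff[of x]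
    by (auto simp: mult_le_0_iff not_less[symmetric] simp del: inner_gt_zero_iff)
  then have "\<exists>B. B ** P = mat 1"
    by (simp add: matrix_left_invertible_ker)
  then have "\<exists>B. P ** B = mat 1 \<and> B ** P = mat 1"
    by (metis matrix_left_right_inverse)
  then have "P ** matrix_inv P = mat 1 \<and> matrix_inv P ** P = mat 1"
    unfolding matrix_inv_def by (rule someI_ex)
  then show "matrix_inv P ** P = mat 1" "P ** matrix_inv P = mat 1"
    by auto
qed

lemma simultaneous_diagonalization:
  fixes P X :: "real^'m^'m"
  assumes sym: "transpose P = P" "transpose X = X"
    and pos: "0 < \<alpha>" "\<And>x. \<alpha> * (x \<bullet> x) \<le> x \<bullet> (P *v x)"
  obtains V :: "real^'m^'m" where "transpose V ** P ** V = mat 1"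
    "\<And>i j. i \<noteq> j \<Longrightarrow> (transpose V ** X ** V) $ i $ j = 0"
proof -
  obtain v :: "'m \<Rightarrow> real^'m"
    where v: "\<And>i. v i \<bullet> (P *v v i) = 1"
      "\<And>i j. i \<noteq> j \<Longrightarrow> v i \<bullet> (P *v v j) = 0" "\<And>i j. i \<noteq> j \<Longrightarrow> v i \<bullet> (X *v v j) = 0"
    using simultaneous_orthogonal_family[OF assms, of UNIV] by simp metis
  define V :: "real^'m^'m" where "V = (\<chi> i j. v j $ i)"
  have col: "column j V = v j" for j
    by (simp add: column_def V_def)
  show ?thesis
    by (rule that[of V]) (auto simp: vec_eq_iff entry_congruence col v mat_def)
qed

text \<open>The concave function ln det lies below its tangent at \<open>P\<close>. In coordinates
  where \<open>P\<close> is the identity and \<open>X\<close> is diagonal with entries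
  \<open>l i\<close>, the determinant ratio is the product and the trace the sum of the
  \<open>l i\<close>, so the claim is a sum of scalar tangent inequalities for ln.\<close>

lemma ln_det_le_trace:
  fixes P X :: "real^'m^'m"
  assumes sym: "transpose P = P" "transpose X = X"
    and "0 < \<alpha>" and P: "\<And>x. \<alpha> * (x \<bullet> x) \<le> x \<bullet> (P *v x)"
    and X: "\<And>x. \<alpha> * (x \<bullet> x) \<le> x \<bullet> (X *v x)"
  shows "ln (det X) \<le> ln (det P) + trace (matrix_inv P ** X) - real CARD('m)"
proof -
  obtain V :: "real^'m^'m" where V: "transpose V ** P ** V = mat 1"
    and off: "\<And>i j. i \<noteq> j \<Longrightarrow> (transpose V ** X ** V) $ i $ j = 0"
    using simultaneous_diagonalization[OF sym \<open>0 < \<alpha>\<close> P] by blast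
  define l where "l i = (transpose V ** X ** V) $ i $ i" for i
  have detP: "det V * det P * det V = 1"
    using arg_cong[OF V, of det] by (simp add: det_mul)
  then have nz: "det V \<noteq> 0" by auto
  \<comment> \<open>Each column of \<open>V\<close> has P-form 1 and is therefore nonzero;
    coercivity of \<open>X\<close> then makes its X-form positive.\<close>
  have l: "l i > 0" for i
  proof -
    have "column i V \<bullet> (P *v column i V) = 1"
      using entry_congruence[of V P i i] V by (simp add: mat_def)
    then have "column i V \<noteq> 0" by auto
    then have "0 < \<alpha> * (column i V \<bullet> column i V)"
      using \<open>0 < \<alpha>\<close> by simp
    then show ?thesis
      using X[of "column i V"] by (simp add: l_def entry_congruence)
  qed
  have detX: "det V * det X * det V = (\<Prod>i\<in>UNIV. l i)"
    using det_diagonal[of "transpose V ** X ** V"] off by (simp add: det_mul l_def)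
  have "det P = 1 / (det V)\<^sup>2" "det X = prod l UNIV / (det V)\<^sup>2"
    using detP detX nz by (auto simp: field_simps power2_eq_square)
  then have "ln (det X) - ln (det P) = ln (prod l UNIV)"
    using nz l prod_pos[of UNIV l] by (simp add: ln_div del: prod_zero_iff)
  also have "\<dots> = (\<Sum>i\<in>UNIV. ln (l i))"
    using l by (intro ln_prod) (auto simp: less_irrefl dest: less_imp_neq[symmetric])
  also have "\<dots> \<le> (\<Sum>i\<in>UNIV. l i - 1)"
    using l by (intro sum_mono ln_le_minus_one) auto
  also have "\<dots> = trace (transpose V ** X ** V) - real CARD('m)"
    by (simp add: trace_def l_def sum_subtractf)
  also have "trace (transpose V ** X ** V) = trace ((V ** transpose V) ** X)"
    by (metis matrix_mul_assoc trace_mul_sym)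
  \<comment> \<open>Square matrices commute with their inverses:
    \<open>transpose V ** (P ** V) = mat 1\<close> also gives
    \<open>(P ** V) ** transpose V = mat 1\<close>.\<close>
  also have "V ** transpose V = matrix_inv P"
  proof -
    have "(P ** V) ** transpose V = mat 1"
      using V by (metis matrix_left_right_inverse matrix_mul_assoc)
    then have "matrix_inv P ** (P ** (V ** transpose V)) = matrix_inv P"
      by (simp add: matrix_mul_assoc)
    then show ?thesis
      by (simp add: matrix_mul_assoc matrix_inv_left_right[OF \<open>0 < \<alpha>\<close> P])
  qed
  finally show ?thesis by simp
qed

lemma matrix_inv_transpose:
  fixes P :: "real^'m^'m"
  assumes "transpose P = P" "0 < \<alpha>" "\<And>x. \<alpha> * (x \<bullet> x) \<le> x \<bullet> (P *v x)"
  shows "transpose (matrix_inv P) = matrix_inv P"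
proof -
  note inv = matrix_inv_left_right[OF assms(2,3)]
  have "transpose (matrix_inv P) ** P = mat 1"
    using arg_cong[OF inv(2), of transpose] assms(1) by (simp add: matrix_transpose_mul)
  then have "transpose (matrix_inv P) ** (P ** matrix_inv P) = matrix_inv P"
    by (simp add: matrix_mul_assoc)
  then show ?thesis
    by (simp add: inv)
qed

section \<open>Spectral-norm estimates and the gap of the majorizer\<close>

lemma spec_norm_nonneg: "0 \<le> spec_norm (M :: real^'n^'m)"
  unfolding spec_norm_def by (rule onorm_pos_le) simp

lemma spec_norm_mult_le:
  fixes A :: "real^'n^'m" and B :: "real^'k^'n"
  shows "spec_norm (A ** B) \<le> spec_norm A * spec_norm B"
  using onorm_compose[of "(*v) A" "(*v) B"]
  by (simp add: spec_norm_def o_def matrix_vector_mul_assoc)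

lemma trace_le_spec_norm:
  fixes M :: "real^'m^'m"
  shows "trace M \<le> real CARD('m) * spec_norm M"
proof -
  have "M $ i $ i \<le> spec_norm M" for i
    using matrix_component_le_onorm[of M i i] by (simp add: spec_norm_def)
  then show ?thesis
    unfolding trace_def using sum_bounded_above[of UNIV "\<lambda>i. M $ i $ i"] by simp
qed

text \<open>With \<open>y\<close> the solution of \<open>P *v y = x\<close>, coercivity and
  Cauchy-Schwarz give \<alpha> |y|^2 \<le> y . x \<le> |y| |x|.\<close>

lemma spec_norm_matrix_inv_le:
  fixes P :: "real^'m^'m"
  assumes "0 < \<alpha>" "\<And>x. \<alpha> * (x \<bullet> x) \<le> x \<bullet> (P *v x)"
  shows "spec_norm (matrix_inv P) \<le> 1 / \<alpha>"
  unfolding spec_norm_def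
proof (rule onorm_le)
  fix x
  define y where "y = matrix_inv P *v x"
  have "P *v y = x"
    by (simp add: y_def matrix_vector_mul_assoc matrix_inv_left_right[OF assms])
  then have "\<alpha> * (norm y * norm y) \<le> y \<bullet> x"
    using assms(2)[of y] by (simp add: power2_norm_eq_inner flip: power2_eq_square)
  also have "\<dots> \<le> norm y * norm x"
    by (rule norm_cauchy_schwarz)
  finally have "\<alpha> * norm y * norm y \<le> norm x * norm y"
    by (simp add: mult_ac)
  then have "\<alpha> * norm y \<le> norm x"
    by (cases "y = 0") auto
  then show "norm (matrix_inv P *v x) \<le> 1 / \<alpha> * norm x"
    using assms(1) by (simp add: y_def field_simps)
qed

lemma matrix_mult_diff_right:
  fixes A :: "'a::ring_1^'n^'m" and B C :: "'a^'k^'n"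
  shows "A ** (B - C) = A ** B - A ** C"
  by (simp add: matrix_matrix_mult_def vec_eq_iff right_diff_distrib sum_subtractf)

lemma matrix_mult_diff_left:
  fixes A :: "'a::ring_1^'k^'n" and B C :: "'a^'n^'m"
  shows "(B - C) ** A = B ** A - C ** A"
  by (simp add: matrix_matrix_mult_def vec_eq_iff left_diff_distrib sum_subtractf)

text \<open>Adding the tangent inequality with \<open>P\<close> and \<open>X\<close> exchanged
  cancels both log-determinants. What remains is the trace of a product with two factors
  \<open>X - P\<close>, so the gap is of second order and does not affect first-order
  conditions.\<close>

lemma ln_det_majorizer_gap_le:
  fixes P X :: "real^'m^'m"
  assumes sym: "transpose P = P" "transpose X = X"
    and "0 < \<alpha>" and P: "\<And>x. \<alpha> * (x \<bullet> x) \<le> x \<bullet> (P *v x)"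
    and X: "\<And>x. \<alpha> * (x \<bullet> x) \<le> x \<bullet> (X *v x)"
  shows "ln (det P) + trace (matrix_inv P ** X) - real CARD('m) - ln (det X)
    \<le> real CARD('m) / \<alpha>\<^sup>2 * (spec_norm (X - P))\<^sup>2"
proof -
  let ?P' = "matrix_inv P" and ?X' = "matrix_inv X"
  note Pi = matrix_inv_left_right[OF \<open>0 < \<alpha>\<close> P] and Xi = matrix_inv_left_right[OF \<open>0 < \<alpha>\<close> X]
  have "ln (det P) \<le> ln (det X) + trace (?X' ** P) - real CARD('m)"
    by (rule ln_det_le_trace[OF sym(2,1) \<open>0 < \<alpha>\<close> X P])
  then have "ln (det P) + trace (?P' ** X) - real CARD('m) - ln (det X)
      \<le> trace (?P' ** X) + trace (?X' ** P) - 2 * real CARD('m)"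
    by simp
  also have "\<dots> = trace (?P' ** X + ?X' ** P - mat 1 - mat 1)"
    by (simp only: trace_add trace_sub trace_I)
  also have "?P' ** X + ?X' ** P - mat 1 - mat 1 = (?P' ** (X - P)) ** (?X' ** (X - P))"
  proof -
    have "?P' ** (X - P) = ?P' ** X - mat 1" "?X' ** (X - P) = mat 1 - ?X' ** P"
      by (simp_all add: matrix_mult_diff_right Pi Xi)
    moreover have "?P' ** X ** (?X' ** P) = mat 1"
      by (metis Pi(1) Xi(2) matrix_mul_assoc matrix_mul_rid)
    ultimately show ?thesis
      by (simp add: matrix_mult_diff_right matrix_mult_diff_left)
  qed
  also have "trace \<dots> \<le> real CARD('m) * spec_norm ((?P' ** (X - P)) ** (?X' ** (X - P)))"
    by (rule trace_le_spec_norm)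
  also have "\<dots> \<le> real CARD('m) * ((1 / \<alpha> * spec_norm (X - P)) * (1 / \<alpha> * spec_norm (X - P)))"
  proof (intro mult_left_mono order_trans[OF spec_norm_mult_le] mult_mono)
    show "spec_norm ?P' \<le> 1 / \<alpha>" "spec_norm ?X' \<le> 1 / \<alpha>"
      using spec_norm_matrix_inv_le[OF \<open>0 < \<alpha>\<close>] P X by auto
  qed (use \<open>0 < \<alpha>\<close> in \<open>auto simp: spec_norm_nonneg\<close>)
  finally show ?thesis
    by (simp add: power2_eq_square)
qed

text \<open>Both quantities are the same linear function, one evaluated at the empirical second
  moment matrix and the other at the identity. Their difference is a sum of m^3 terms, each at most
  \<open>p * q * s\<close>; the bound is uniform over all \<open>K\<close> and \<open>X\<close> with
  these entry bounds.\<close>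

lemma trace_estimate_error_le:
  fixes K X :: "real^'m^'m" and w :: "nat \<Rightarrow> real^'m"
  assumes moment: "\<And>a b. \<bar>(1 / real N) * (\<Sum>i<N. w i $ a * w i $ b) - (if a = b then 1 else 0)\<bar> \<le> s"
    and K: "\<And>a b. \<bar>K $ a $ b\<bar> \<le> p" and X: "\<And>a b. \<bar>X $ a $ b\<bar> \<le> q"
  shows "\<bar>(1 / real N) * (\<Sum>i<N. (K *v w i) \<bullet> (X *v w i)) - trace (transpose K ** X)\<bar>
    \<le> real CARD('m) ^ 3 * (p * q * s)"
proof -
  define S where "S a b = (1 / real N) * (\<Sum>i<N. w i $ a * w i $ b)" for a b
  define d where "d a b = (if a = b then 1 else 0 :: real)" for a b :: 'm
  have "(1 / real N) * (\<Sum>i<N. (K *v w i) \<bullet> (X *v w i))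
      = (1 / real N) * (\<Sum>i<N. \<Sum>c\<in>UNIV. \<Sum>a\<in>UNIV. \<Sum>b\<in>UNIV. K $ c $ a * X $ c $ b * (w i $ a * w i $ b))"
    by (simp add: inner_vec_def matrix_vector_mult_def sum_product mult_ac)
  also have "\<dots> = (1 / real N) * (\<Sum>c\<in>UNIV. \<Sum>a\<in>UNIV. \<Sum>b\<in>UNIV. K $ c $ a * X $ c $ b * (\<Sum>i<N. w i $ a * w i $ b))"
    by (simp add: sum_distrib_left sum.swap[of _ _ "{..<N}"])
  also have "\<dots> = (\<Sum>c\<in>UNIV. \<Sum>a\<in>UNIV. \<Sum>b\<in>UNIV. K $ c $ a * X $ c $ b * S a b)"
    by (simp add: sum_distrib_left S_def mult_ac)
  finally have 1: "(1 / real N) * (\<Sum>i<N. (K *v w i) \<bullet> (X *v w i)) = \<dots>" .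
  have "trace (transpose K ** X) = (\<Sum>a\<in>UNIV. \<Sum>c\<in>UNIV. K $ c $ a * X $ c $ a)"
    by (simp add: trace_def matrix_matrix_mult_def transpose_def)
  also have "\<dots> = (\<Sum>c\<in>UNIV. \<Sum>a\<in>UNIV. K $ c $ a * X $ c $ a)"
    by (rule sum.swap)
  also have "\<dots> = (\<Sum>c\<in>UNIV. \<Sum>a\<in>UNIV. \<Sum>b\<in>UNIV. K $ c $ a * X $ c $ b * d a b)"
    by (simp add: d_def if_distrib cong: if_cong)
  finally have 2: "trace (transpose K ** X) = \<dots>" .
  have "\<bar>K $ c $ a * X $ c $ b * (S a b - d a b)\<bar> \<le> p * q * s" for a b c
  proof -
    have "0 \<le> p" "0 \<le> q"
      using K[of a b] X[of a b] by auto
    then show ?thesis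
      unfolding abs_mult using K[of c a] X[of c b] moment[of a b]
      by (intro mult_mono) (auto simp: S_def d_def)
  qed
  then have "(\<Sum>c\<in>UNIV. \<Sum>a\<in>UNIV. \<Sum>b\<in>UNIV. \<bar>K $ c $ a * X $ c $ b * (S a b - d a b)\<bar>)
      \<le> (\<Sum>c\<in>(UNIV::'m set). \<Sum>a\<in>(UNIV::'m set). \<Sum>b\<in>(UNIV::'m set). p * q * s)"
    by (intro sum_mono)
  moreover have "\<bar>\<Sum>c\<in>UNIV. \<Sum>a\<in>UNIV. \<Sum>b\<in>UNIV. K $ c $ a * X $ c $ b * (S a b - d a b)\<bar>
      \<le> (\<Sum>c\<in>UNIV. \<Sum>a\<in>UNIV. \<Sum>b\<in>UNIV. \<bar>K $ c $ a * X $ c $ b * (S a b - d a b)\<bar>)"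
    by (intro order_trans[OF sum_abs] sum_mono order_refl)
  ultimately show ?thesis
    unfolding 1 2 by (simp add: sum_subtractf right_diff_distrib power3_eq_cube mult_ac)
qed

section \<open>Inexact descent\<close>

text \<open>Subtracting the partial sums of \<open>e\<close> turns the approximate descent into a
  monotone sequence. The shift by \<open>T\<close> discards the initial indices where descent is not
  assumed.\<close>

lemma quasi_descent_convergent:
  fixes f e :: "nat \<Rightarrow> real"
  assumes descent: "\<And>t. T \<le> t \<Longrightarrow> f (Suc t) \<le> f t + e t"
    and "summable e" and low: "\<And>t. B \<le> f t"
  shows "convergent f"
proof -
  define g where "g t = f (t + T) - (\<Sum>i<t + T. e i)" for t
  have E: "(\<lambda>t. \<Sum>i<t + T. e i) \<longlonglongrightarrow> suminf e"
    using summable_LIMSEQ[OF \<open>summable e\<close>] by (rule LIMSEQ_ignore_initial_segment)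
  then obtain H where H: "\<And>t. norm (\<Sum>i<t + T. e i) \<le> H"
    by (metis Bseq_def convergentI convergent_imp_Bseq)
  have "decseq g"
    using descent by (intro decseq_SucI) (simp add: g_def algebra_simps)
  moreover have "B - H \<le> g t" for t
    using H[of t] low[of "t + T"] by (simp add: g_def)
  ultimately obtain l where "g \<longlonglongrightarrow> l"
    using decseq_convergent by blast
  from tendsto_add[OF this E] have "(\<lambda>t. f (t + T)) \<longlonglongrightarrow> l + suminf e"
    by (simp add: g_def)
  then show ?thesis
    using LIMSEQ_offset convergentI by blast
qed

text \<open>Values converge along the whole sequence, not only along \<open>s\<close>. This controls
  the successors \<open>x (Suc (s k))\<close>, which themselves need not converge, and lets the step
  inequality pass to the limit.\<close>

lemma accumulation_point_stationary:
  fixes F :: "'e::euclidean_space \<Rightarrow> real" and x :: "nat \<Rightarrow> 'e" and e :: "nat \<Rightarrow> real"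
  assumes \<Theta>: "compact \<Theta>" "convex \<Theta>"
    and der: "\<And>y. y \<in> \<Theta> \<Longrightarrow> (F has_derivative F' y) (at y)"
    and x: "\<And>t. x t \<in> \<Theta>" and e: "summable e"
    and step: "\<And>t y. T \<le> t \<Longrightarrow> y \<in> \<Theta> \<Longrightarrow> F (x (Suc t)) \<le> F y + C * (norm (y - x t))\<^sup>2 + e t"
    and s: "strict_mono s" "(\<lambda>k. x (s k)) \<longlonglongrightarrow> z" and y: "y \<in> \<Theta>"
  shows "0 \<le> F' z (y - z)"
proof -
  have cont: "continuous_on \<Theta> F"
    using der by (intro continuous_at_imp_continuous_on ballI has_derivative_continuous) blast
  have z: "z \<in> \<Theta>"
    using closed_sequentially[OF compact_imp_closed[OF \<Theta>(1)] _ s(2)] x by blast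
  have "bdd_below (F ` \<Theta>)"
    by (intro bounded_imp_bdd_below compact_imp_bounded compact_continuous_image[OF cont \<Theta>(1)])
  then obtain B where B: "B \<le> F (x t)" for t
    using x by (auto simp: bdd_below_def)
  have "convergent (\<lambda>t. F (x t))"
  proof (rule quasi_descent_convergent[OF _ e B])
    show "F (x (Suc t)) \<le> F (x t) + e t" if "T \<le> t" for t
      using step[OF that x[of t]] by simp
  qed
  then obtain l where l: "(\<lambda>t. F (x t)) \<longlonglongrightarrow> l"
    by (auto simp: convergent_def)
  have "(\<lambda>k. F (x (s k))) \<longlonglongrightarrow> l"
    using LIMSEQ_subseq_LIMSEQ[OF l s(1)] by (simp add: o_def)
  moreover have "(\<lambda>k. F (x (s k))) \<longlonglongrightarrow> F z"
    using continuous_on_tendsto_compose[OF cont s(2) z] x by simp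
  ultimately have [simp]: "l = F z"
    by (rule LIMSEQ_unique)
  have next_lim: "(\<lambda>k. F (x (Suc (s k)))) \<longlonglongrightarrow> F z"
    using LIMSEQ_subseq_LIMSEQ[OF LIMSEQ_Suc[OF l] s(1)] by (simp add: o_def)
  have elim: "(\<lambda>k. e (s k)) \<longlonglongrightarrow> 0"
    using LIMSEQ_subseq_LIMSEQ[OF summable_LIMSEQ_zero[OF e] s(1)] by (simp add: o_def)
  have key: "F z \<le> F u + C * (norm (u - z))\<^sup>2" if u: "u \<in> \<Theta>" for u
  proof (rule LIMSEQ_le[OF next_lim])
    have "(\<lambda>k. F u + C * (norm (u - x (s k)))\<^sup>2 + e (s k)) \<longlonglongrightarrow> F u + C * (norm (u - z))\<^sup>2 + 0"
      by (intro tendsto_intros s(2) elim)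
    then show "(\<lambda>k. F u + C * (norm (u - x (s k)))\<^sup>2 + e (s k)) \<longlonglongrightarrow> F u + C * (norm (u - z))\<^sup>2"
      by simp
    have "F (x (Suc (s k))) \<le> F u + C * (norm (u - x (s k)))\<^sup>2 + e (s k)" if "T \<le> k" for k
      using step[of "s k" u] u that seq_suble[OF s(1), of k] by linarith
    then show "\<exists>N. \<forall>k\<ge>N. F (x (Suc (s k))) \<le> F u + C * (norm (u - x (s k)))\<^sup>2 + e (s k)"
      by blast
  qed
  define d where "d = y - z"
  \<comment> \<open>The penalized objective along the segment from \<open>z\<close> to
    \<open>y\<close>. The penalty is quadratic in \<open>h\<close>, so the derivative at 0 is that
    of \<open>F\<close> alone.\<close>
  define \<phi> where "\<phi> h = F (z + h *\<^sub>R d) + C * (h * norm d)\<^sup>2" for h :: real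
  have "((\<lambda>h. F (z + h *\<^sub>R d)) has_derivative (\<lambda>h. F' z (h *\<^sub>R d))) (at 0)"
  proof (rule has_derivative_compose[where g = F and f = "\<lambda>h. z + h *\<^sub>R d" and f' = "\<lambda>h. h *\<^sub>R d"])
    show "((\<lambda>h. z + h *\<^sub>R d) has_derivative (\<lambda>h. h *\<^sub>R d)) (at 0)"
      by (auto intro!: derivative_eq_intros)
    show "(F has_derivative F' z) (at (z + 0 *\<^sub>R d))"
      using der[OF z] by simp
  qed
  moreover have "F' z (h *\<^sub>R d) = F' z d * h" for h
    using linear_cmul[OF has_derivative_linear[OF der[OF z]]] by simp
  ultimately have "((\<lambda>h. F (z + h *\<^sub>R d)) has_real_derivative F' z d) (at 0)"
    by (simp add: has_field_derivative_def)
  then have D: "(\<phi> has_real_derivative F' z d) (at 0)"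
    unfolding \<phi>_def by (auto intro!: derivative_eq_intros)
  show ?thesis
  proof (rule ccontr)
    assume "\<not> 0 \<le> F' z (y - z)"
    then have "F' z d < 0"
      by (simp add: d_def)
    from DERIV_neg_dec_right[OF D this] obtain h0
      where h0: "h0 > 0" "\<And>h. 0 < h \<Longrightarrow> h < h0 \<Longrightarrow> \<phi> (0 + h) < \<phi> 0"
      by blast
    \<comment> \<open>Half of \<open>h0\<close> stays strictly inside the range of decrease; the cap
      1 keeps the point on the segment and hence in \<Theta>.\<close>
    define h where "h = min (h0 / 2) 1"
    have h: "0 < h" "h < h0" "h \<le> 1"
      using h0(1) by (auto simp: h_def)
    have "z + h *\<^sub>R d = (1 - h) *\<^sub>R z + h *\<^sub>R y"
      by (simp add: d_def algebra_simps)
    then have "z + h *\<^sub>R d \<in> \<Theta>"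
      using convexD[OF \<Theta>(2) z y, of "1 - h" h] h by simp
    from key[OF this] have "\<phi> 0 \<le> \<phi> h"
      using h by (simp add: \<phi>_def)
    then show False
      using h0(2)[of h] h by simp
  qed
qed

section \<open>Rademacher second moments\<close>

context prob_space
begin

text \<open>The two atoms exhaust the probability mass, so \<open>f\<close> agrees almost everywhere
  with a difference of two indicators of equal probability.\<close>

lemma sign_variable:
  fixes f :: "'a \<Rightarrow> real"
  assumes [measurable]: "f \<in> borel_measurable M"
    and "prob {\<omega>\<in>space M. f \<omega> = 1} = 1/2" "prob {\<omega>\<in>space M. f \<omega> = -1} = 1/2"
  shows AE_sign_variable: "AE \<omega> in M. f \<omega> = 1 \<or> f \<omega> = -1"
    and expectation_sign_variable: "expectation f = 0"
proof -
  let ?P = "{\<omega>\<in>space M. f \<omega> = 1}" and ?Q = "{\<omega>\<in>space M. f \<omega> = -1}"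
  have [measurable]: "?P \<in> events" "?Q \<in> events"
    by measurable
  have "prob (?P \<union> ?Q) = prob ?P + prob ?Q"
    by (intro finite_measure_Union) auto
  also have "\<dots> = 1"
    using assms by simp
  finally have "AE \<omega> in M. \<omega> \<in> ?P \<union> ?Q"
    by (intro AE_prob_1)
  then show ae: "AE \<omega> in M. f \<omega> = 1 \<or> f \<omega> = -1"
    by eventually_elim auto
  have "expectation f = expectation (\<lambda>\<omega>. indicator ?P \<omega> - indicator ?Q \<omega>)"
  proof (rule integral_cong_AE)
    show "AE \<omega> in M. f \<omega> = indicator ?P \<omega> - indicator ?Q \<omega>"
      using ae AE_space by eventually_elim (auto simp: indicator_def)
  qed measurable
  also have "\<dots> = prob ?P - prob ?Q"
    by (subst Bochner_Integration.integral_diff) (auto simp: integrable_indicator_iff emeasure_eq_measure)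
  finally show "expectation f = 0"
    using assms by simp
qed

text \<open>For \<open>a = b\<close> the summands are squares of signs and the event is null.
  Otherwise they are independent over \<open>i\<close>, have mean zero because two distinct
  coordinates are independent, and lie in an interval of length 2; Hoeffding's exponent is 2 (N s)^2
  / (4 N) = N s^2 / 2.\<close>

lemma rademacher_second_moment_tail:
  fixes w :: "nat \<Rightarrow> 'a \<Rightarrow> real^'m"
  assumes "0 < N" "0 < s"
    and indep: "indep_vars (\<lambda>_. borel) (\<lambda>(i, j) \<omega>. w i \<omega> $ j) ({..<N} \<times> UNIV)"
    and sign: "\<And>i j. i < N \<Longrightarrow> prob {\<omega>\<in>space M. w i \<omega> $ j = 1} = 1/2
      \<and> prob {\<omega>\<in>space M. w i \<omega> $ j = -1} = 1/2"
  shows "prob {\<omega>\<in>space M. s \<le> \<bar>(1 / real N) * (\<Sum>i<N. w i \<omega> $ a * w i \<omega> $ b) - (if a = b then 1 else 0)\<bar>}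
    \<le> 2 * exp (- (real N * s\<^sup>2 / 2))"
proof -
  have rv: "(\<lambda>\<omega>. w i \<omega> $ j) \<in> borel_measurable M" if "i < N" for i j
    using indep that unfolding indep_vars_def by auto
  have ae: "AE \<omega> in M. w i \<omega> $ j = 1 \<or> w i \<omega> $ j = -1" if "i < N" for i j
    using AE_sign_variable[OF rv] sign that by blast
  have ex0: "expectation (\<lambda>\<omega>. w i \<omega> $ j) = 0" if "i < N" for i j
    using expectation_sign_variable[OF rv] sign that by blast
  show ?thesis
  proof (cases "a = b")
    case True
    have "AE \<omega> in M. \<forall>i\<in>{..<N}. w i \<omega> $ a * w i \<omega> $ a = 1"
    proof (rule AE_finite_allI)
      show "AE \<omega> in M. w i \<omega> $ a * w i \<omega> $ a = 1" if "i \<in> {..<N}" for i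
        using ae[of i a] that by auto
    qed simp
    then have "AE \<omega> in M. \<not> s \<le> \<bar>(1 / real N) * (\<Sum>i<N. w i \<omega> $ a * w i \<omega> $ a) - 1\<bar>"
      by eventually_elim (use assms in simp)
    then have "prob {\<omega>\<in>space M. s \<le> \<bar>(1 / real N) * (\<Sum>i<N. w i \<omega> $ a * w i \<omega> $ a) - 1\<bar>} = 0"
      by (rule prob_eq_0_AE)
    with True show ?thesis by simp
  next
    case False
    define X where "X i \<omega> = w i \<omega> $ a * w i \<omega> $ b" for i \<omega>
    \<comment> \<open>The index pairs \<open>{(i, a), (i, b)}\<close> are disjoint for different
      \<open>i\<close>, so functions of these blocks, in particular the products, are
      independent.\<close>
    have "indep_vars (\<lambda>i. PiM {(i, a), (i, b)} (\<lambda>_. borel))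
        (\<lambda>i \<omega>. \<lambda>k\<in>{(i, a), (i, b)}. (\<lambda>(i, j) \<omega>. w i \<omega> $ j) k \<omega>) {..<N}"
      by (intro indep_vars_restrict[OF indep]) (auto simp: disjoint_family_on_def)
    from indep_vars_compose2[OF this, where Y = "\<lambda>i g. g (i, a) * g (i, b)" and N = "\<lambda>_. borel"]
    have indX: "indep_vars (\<lambda>_. borel) X {..<N}"
      by (simp add: X_def[abs_def])
    have exX: "expectation (X i) = 0" if "i < N" for i
    proof -
      have sub: "indep_vars (\<lambda>_. borel) (\<lambda>(i, j) \<omega>. w i \<omega> $ j) {(i, a), (i, b)}"
        using indep that by (intro indep_vars_subset[OF indep]) auto
      have int: "integrable M (\<lambda>\<omega>. w i \<omega> $ j)" for j
        using ae[OF that, of j] by (intro integrable_const_bound[where B = 1] rv that) auto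
      have "expectation (\<lambda>\<omega>. \<Prod>k\<in>{(i, a), (i, b)}. (\<lambda>(i, j) \<omega>. w i \<omega> $ j) k \<omega>)
          = (\<Prod>k\<in>{(i, a), (i, b)}. expectation ((\<lambda>(i, j) \<omega>. w i \<omega> $ j) k))"
        by (rule indep_vars_lebesgue_integral[OF _ sub]) (auto simp: int)
      then show ?thesis
        using False ex0[OF that] by (simp add: X_def[abs_def])
    qed
    interpret H: Hoeffding_ineq M "{..<N}" X "\<lambda>_. -1" "\<lambda>_. 1" "\<Sum>i<N. expectation (X i)"
    proof unfold_locales
      show "AE \<omega> in M. X i \<omega> \<in> {-1..1}" if "i \<in> {..<N}" for i
        using ae[of i a] ae[of i b] that by (auto simp: X_def)
    qed (auto simp: indX)
    have sq: "(\<Sum>i<N. (1 - (-1 :: real))\<^sup>2) = 4 * real N"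
      by simp
    have "prob {\<omega>\<in>space M. real N * s \<le> \<bar>(\<Sum>i<N. X i \<omega>) - (\<Sum>i<N. expectation (X i))\<bar>}
        \<le> 2 * exp (- 2 * (real N * s)\<^sup>2 / (\<Sum>i<N. (1 - (-1 :: real))\<^sup>2))"
      using assms(1,2) by (intro H.Hoeffding_ineq_abs_ge) auto
    also have "(\<Sum>i<N. expectation (X i)) = 0"
      by (simp add: exX)
    also have "- 2 * (real N * s)\<^sup>2 / (\<Sum>i<N. (1 - (-1 :: real))\<^sup>2) = - (real N * s\<^sup>2 / 2)"
      unfolding sq using assms(1) by (simp add: power2_eq_square field_simps)
    also have "{\<omega>\<in>space M. real N * s \<le> \<bar>(\<Sum>i<N. X i \<omega>) - 0\<bar>}
        = {\<omega>\<in>space M. s \<le> \<bar>(1 / real N) * (\<Sum>i<N. X i \<omega>)\<bar>}"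
      using assms(1) by (simp add: abs_mult abs_divide field_simps)
    finally show ?thesis
      using False by (simp add: X_def)
  qed
qed

text \<open>A union bound over the m^2 entries keeps the failure probabilities summable in
  \<open>t\<close>; by the first Borel-Cantelli lemma almost every outcome fails only finitely
  often.\<close>

lemma AE_eventually_rademacher_second_moment:
  fixes w :: "nat \<Rightarrow> nat \<Rightarrow> 'a \<Rightarrow> real^'m"
  assumes N: "\<And>t. 0 < N t" and s: "\<And>t. 0 < s t"
    and indep: "\<And>t. indep_vars (\<lambda>_. borel) (\<lambda>(i, j) \<omega>. w t i \<omega> $ j) ({..<N t} \<times> UNIV)"
    and sign: "\<And>t i j. i < N t \<Longrightarrow> prob {\<omega>\<in>space M. w t i \<omega> $ j = 1} = 1/2
      \<and> prob {\<omega>\<in>space M. w t i \<omega> $ j = -1} = 1/2"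
    and sum: "summable (\<lambda>t. exp (- (real (N t) * (s t)\<^sup>2 / 2)))"
  shows "AE \<omega> in M. eventually (\<lambda>t. \<forall>a b.
    \<bar>(1 / real (N t)) * (\<Sum>i<N t. w t i \<omega> $ a * w t i \<omega> $ b) - (if a = b then 1 else 0)\<bar> \<le> s t) sequentially"
proof -
  define D where "D t a b \<omega> =
    \<bar>(1 / real (N t)) * (\<Sum>i<N t. w t i \<omega> $ a * w t i \<omega> $ b) - (if a = b then 1 else 0)\<bar>" for t a b \<omega>
  define B where "B t = (\<Union>(a, b)\<in>UNIV. {\<omega>\<in>space M. s t \<le> D t a b \<omega>})" for t
  have rv: "(\<lambda>\<omega>. w t i \<omega> $ j) \<in> borel_measurable M" if "i < N t" for t i j
    using indep[of t] that unfolding indep_vars_def by auto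
  have Dm [measurable]: "D t a b \<in> borel_measurable M" for t a b
    unfolding D_def using rv
    by (intro borel_measurable_abs borel_measurable_diff borel_measurable_times
        borel_measurable_sum borel_measurable_const) auto
  have Bm [measurable]: "B t \<in> events" for t
    unfolding B_def by (intro sets.finite_UN) (auto split: prod.splits)
  have "prob (B t) \<le> real (card (UNIV :: ('m \<times> 'm) set)) * (2 * exp (- (real (N t) * (s t)\<^sup>2 / 2)))" for t
  proof -
    have "prob (B t) \<le> (\<Sum>(a, b)\<in>UNIV. prob {\<omega>\<in>space M. s t \<le> D t a b \<omega>})"
      unfolding B_def
      using finite_measure_subadditive_finite[of UNIV "\<lambda>(a, b). {\<omega>\<in>space M. s t \<le> D t a b \<omega>}"]
      by (simp add: case_prod_unfold image_subset_iff)
    also have "\<dots> \<le> (\<Sum>p\<in>(UNIV :: ('m \<times> 'm) set). 2 * exp (- (real (N t) * (s t)\<^sup>2 / 2)))"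
      using rademacher_second_moment_tail[OF N s indep sign]
      by (intro sum_mono) (auto simp: D_def)
    finally show ?thesis by simp
  qed
  then have "summable (\<lambda>t. prob (B t))"
    by (intro summable_comparison_test'[OF summable_mult[OF summable_mult[OF sum]]]) auto
  then have "AE \<omega> in M. eventually (\<lambda>t. \<omega> \<in> space M - B t) sequentially"
    by (intro borel_cantelli_AE1) (auto simp: emeasure_eq_measure)
  then show ?thesis
  proof eventually_elim
    case (elim \<omega>)
    then show ?case
    proof eventually_elim
      case (elim t)
      then have "D t a b \<omega> \<le> s t" for a b
        unfolding B_def by (force simp: not_le intro: less_imp_le)
      then show ?case
        by (simp add: D_def)
    qed
  qed
qed

end

section \<open>Convergence of the iterates\<close>

text \<open>Surrogate and objective differ only in the log-determinant part, which carries a factor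
  1/2; hence \<open>d / 2\<close> and the coefficient m / (2 \<alpha>^2). The first bound rests on
  the tangent inequality, the second on the gap estimate.\<close>

lemma Ghat_Fobj_bounds:
  fixes A :: "'p \<Rightarrow> real^'n^'m"
  assumes sym: "transpose (Psi A Q R x) = Psi A Q R x" "transpose (Psi A Q R y) = Psi A Q R y"
    and "0 < \<alpha>" and low: "\<And>v. \<alpha> * (v \<bullet> v) \<le> v \<bullet> (Psi A Q R x *v v)"
      "\<And>v. \<alpha> * (v \<bullet> v) \<le> v \<bullet> (Psi A Q R y *v v)"
    and err: "\<bar>(1 / real N) * (\<Sum>i<N. (matrix_inv (Psi A Q R x) *v w i) \<bullet> (Psi A Q R y *v w i))
      - trace (matrix_inv (Psi A Q R x) ** Psi A Q R y)\<bar> \<le> d"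
  shows Fobj_le_Ghat: "Fobj pr A Q R mu b y \<le> Ghat pr A Q R mu b N w x y + d / 2"
    and Ghat_le_Fobj: "Ghat pr A Q R mu b N w x y
      \<le> Fobj pr A Q R mu b y + real CARD('m) / (2 * \<alpha>\<^sup>2) * (spec_norm (Psi A Q R y - Psi A Q R x))\<^sup>2 + d / 2"
proof -
  show "Fobj pr A Q R mu b y \<le> Ghat pr A Q R mu b N w x y + d / 2"
    using ln_det_le_trace[OF sym \<open>0 < \<alpha>\<close> low] err
    unfolding Fobj_def Ghat_def by argo
  have "real CARD('m) / (2 * \<alpha>\<^sup>2) * (spec_norm (Psi A Q R y - Psi A Q R x))\<^sup>2
      = (real CARD('m) / \<alpha>\<^sup>2 * (spec_norm (Psi A Q R y - Psi A Q R x))\<^sup>2) / 2"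
    by simp
  then show "Ghat pr A Q R mu b N w x y
      \<le> Fobj pr A Q R mu b y + real CARD('m) / (2 * \<alpha>\<^sup>2) * (spec_norm (Psi A Q R y - Psi A Q R x))\<^sup>2 + d / 2"
    using ln_det_majorizer_gap_le[OF sym \<open>0 < \<alpha>\<close> low] err
    unfolding Fobj_def Ghat_def by argo
qed

lemma frob_norm_eq_norm: "frob_norm M = norm M"
  by (simp add: frob_norm_def norm_vec_def L2_set_def sum_nonneg)

lemma abs_entry_le_norm: "\<bar>(M :: real^'n^'m) $ a $ b\<bar> \<le> norm M"
  by (rule order_trans[OF component_le_norm_cart Finite_Cartesian_Product.norm_nth_le])

lemma transpose_Psi:
  fixes A :: "'p \<Rightarrow> real^'n^'m"
  assumes "transpose (Q x) = Q x" "transpose (R x) = R x"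
  shows "transpose (Psi A Q R x) = Psi A Q R x"
proof -
  have "transpose (B + C) = transpose B + transpose C" for B C :: "real^'m^'m"
    by (simp add: transpose_def vec_eq_iff)
  then show ?thesis
    using assms by (simp add: Psi_def matrix_transpose_mul matrix_mul_assoc)
qed

theorem theorem4p6:
  fixes \<Theta> :: "(real^'p) set" and c :: "real^'p" and r :: real
    and A :: "real^'p \<Rightarrow> real^'n^'m" and Q :: "real^'p \<Rightarrow> real^'n^'n"
    and R :: "real^'p \<Rightarrow> real^'m^'m" and mu :: "real^'n" and b :: "real^'m"
    and pr :: "real^'p \<Rightarrow> real"
    and L\<Psi> \<alpha> \<beta> :: real
    and DAmu :: "real^'p \<Rightarrow> ((real^'p) \<Rightarrow>\<^sub>L (real^'m))"
    and D\<Psi> :: "real^'p \<Rightarrow> ((real^'p) \<Rightarrow>\<^sub>L (real^'m^'m))"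
    and Dlogpr :: "real^'p \<Rightarrow> ((real^'p) \<Rightarrow>\<^sub>L real)"
    and F' :: "real^'p \<Rightarrow> ((real^'p) \<Rightarrow>\<^sub>L real)"
    and KA K\<Psi> Kpr :: real and U :: "(real^'p) set"
    and \<epsilon> \<delta>s :: "nat \<Rightarrow> real" and \<delta> :: real and N :: "nat \<Rightarrow> nat"
    and M :: "'a measure"
    and W :: "nat \<Rightarrow> nat \<Rightarrow> 'a \<Rightarrow> real^'m"
    and \<theta>hat :: "nat \<Rightarrow> 'a \<Rightarrow> real^'p"
  defines "\<Psi> \<equiv> Psi A Q R"
    and "F \<equiv> Fobj pr A Q R mu b"
    and "\<gamma> \<equiv> (\<lambda>t. max ((12 * r * real CARD('m) * L\<Psi> / (\<epsilon> t * \<alpha>)) ^ CARD('p)) 1)"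
    and "\<sigma>F \<equiv> (1/\<alpha>) * Sup ((\<lambda>\<theta>. frob_norm (Psi A Q R \<theta>)) ` \<Theta>)"
    and "\<sigma>2 \<equiv> (1/\<alpha>) * Sup ((\<lambda>\<theta>. spec_norm (Psi A Q R \<theta>)) ` \<Theta>)"
  assumes Theta: "compact \<Theta>" "convex \<Theta>" "r > 0" "\<Theta> \<subseteq> cball c r"
    and QR_spd: "\<forall>\<theta>\<in>\<Theta>. spd (Q \<theta>) \<and> spd (R \<theta>)"
    and pr_pos: "\<forall>\<theta>. pr \<theta> > 0"
    and Psi_lip: "\<forall>\<theta>\<in>\<Theta>. \<forall>\<theta>'\<in>\<Theta>. spec_norm (\<Psi> \<theta> - \<Psi> \<theta>') \<le> L\<Psi> * norm (\<theta> - \<theta>')"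
    and ab: "0 < \<alpha>" "\<alpha> \<le> \<beta>"
    and Psi_bounds: "\<forall>\<theta>\<in>\<Theta>. loewner_le (\<alpha> *\<^sub>R mat 1) (\<Psi> \<theta>) \<and> loewner_le (\<Psi> \<theta>) (\<beta> *\<^sub>R mat 1)"
    and Amu_C11: "\<forall>\<theta>\<in>\<Theta>. ((\<lambda>\<theta>. A \<theta> *v mu) has_derivative blinfun_apply (DAmu \<theta>)) (at \<theta>)"
      "KA-lipschitz_on \<Theta> DAmu"
    and Psi_C11: "\<forall>\<theta>\<in>\<Theta>. (\<Psi> has_derivative blinfun_apply (D\<Psi> \<theta>)) (at \<theta>)"
      "K\<Psi>-lipschitz_on \<Theta> D\<Psi>"
    and logpr_C11: "\<forall>\<theta>\<in>\<Theta>. ((\<lambda>\<theta>. ln (pr \<theta>)) has_derivative blinfun_apply (Dlogpr \<theta>)) (at \<theta>)"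
      "Kpr-lipschitz_on \<Theta> Dlogpr"
    and F_C1: "open U" "\<Theta> \<subseteq> U" "\<forall>\<theta>\<in>U. (F has_derivative blinfun_apply (F' \<theta>)) (at \<theta>)"
      "continuous_on U F'"
    and eps: "\<forall>t. \<epsilon> t > 0" "summable \<epsilon>"
    and dels: "\<forall>t. \<delta>s t > 0" "\<delta>s sums \<delta>" "\<delta> < 1"
    and Nt: "\<forall>t. real (N t) \<ge> 16 * (2 * \<sigma>F\<^sup>2 + \<epsilon> t * \<sigma>2) / (\<epsilon> t)\<^sup>2 * ln (2 * \<gamma> t / \<delta>s t)"
    and prob: "prob_space M"
    and rademacher_indep:
      "\<forall>t. prob_space.indep_vars M (\<lambda>_. borel) (\<lambda>(i, j) \<omega>. W t i \<omega> $ j) ({..<N t} \<times> UNIV)"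
    and rademacher_dist:
      "\<forall>t. \<forall>i<N t. \<forall>j. measure M {\<omega>\<in>space M. W t i \<omega> $ j = 1} = 1/2
                      \<and> measure M {\<omega>\<in>space M. W t i \<omega> $ j = -1} = 1/2"
    and iterate_meas: "\<forall>t. \<theta>hat t \<in> borel_measurable M"
    and indep_iterate:
      "\<forall>t. prob_space.indep_set M
             {\<theta>hat t -` B \<inter> space M | B. B \<in> sets borel}
             {(\<lambda>\<omega>. \<lambda>i\<in>{..<N t}. W t i \<omega>) -` B \<inter> space M | B. B \<in> sets (Pi\<^sub>M {..<N t} (\<lambda>_. borel))}"
    and iter_in: "\<forall>t. \<forall>\<omega>\<in>space M. \<theta>hat t \<omega> \<in> \<Theta>"
    and iter_argmin: "\<forall>t. \<forall>\<omega>\<in>space M. \<forall>\<theta>\<in>\<Theta>.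
        Ghat pr A Q R mu b (N t) (\<lambda>i. W t i \<omega>) (\<theta>hat t \<omega>) (\<theta>hat (Suc t) \<omega>)
          \<le> Ghat pr A Q R mu b (N t) (\<lambda>i. W t i \<omega>) (\<theta>hat t \<omega>) \<theta>"
  shows "\<exists>E\<in>sets M. measure M E \<ge> 1 - \<delta> \<and>
           (\<forall>\<omega>\<in>E. \<forall>\<theta>s. (\<exists>s. strict_mono s \<and> (\<lambda>k. \<theta>hat (s k) \<omega>) \<longlonglongrightarrow> \<theta>s)
                 \<longrightarrow> (\<forall>\<theta>\<in>\<Theta>. blinfun_apply (F' \<theta>s) (\<theta> - \<theta>s) \<ge> 0))"
proof -
  interpret prob_space M by (rule prob)
  obtain \<omega>0 where "\<omega>0 \<in> space M"
    using not_empty by blast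
  then obtain \<theta>0 where \<theta>0: "\<theta>0 \<in> \<Theta>"
    using iter_in by blast
  have sym: "transpose (\<Psi> \<theta>) = \<Psi> \<theta>" if "\<theta> \<in> \<Theta>" for \<theta>
    unfolding \<Psi>_def using QR_spd that by (intro transpose_Psi) (auto simp: spd_def)
  have low: "\<alpha> * (x \<bullet> x) \<le> x \<bullet> (\<Psi> \<theta> *v x)" if "\<theta> \<in> \<Theta>" for \<theta> x
    using Psi_bounds that by (simp add: loewner_le_def flip: scaleR_matrix_vector_assoc)
  have "continuous_on \<Theta> \<Psi>"
    using Psi_C11(1) by (intro continuous_at_imp_continuous_on ballI has_derivative_continuous) blast
  then have "bounded (\<Psi> ` \<Theta>)"
    by (intro compact_imp_bounded compact_continuous_image Theta)
  then obtain Bd where Bd: "\<And>\<theta>. \<theta> \<in> \<Theta> \<Longrightarrow> norm (\<Psi> \<theta>) \<le> Bd"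
    by (auto simp: bounded_iff)
  have entry: "\<bar>\<Psi> \<theta> $ a $ b\<bar> \<le> Bd" if "\<theta> \<in> \<Theta>" for \<theta> a b
    using abs_entry_le_norm Bd[OF that] by (rule order_trans)
  have "\<sigma>F > 0"
  proof -
    \<comment> \<open>Testing coercivity on a unit axis vector rules out the zero matrix. Positivity
      of \<open>\<sigma>F\<close> is needed because it becomes a denominator in
      \<open>s\<close>.\<close>
    have "\<Psi> \<theta>0 \<noteq> 0"
      using low[OF \<theta>0, of "axis undefined 1"] ab(1) by (auto simp: inner_axis_axis)
    moreover have "norm (\<Psi> \<theta>0) \<le> Sup ((\<lambda>\<theta>. frob_norm (\<Psi> \<theta>)) ` \<Theta>)"
      using \<theta>0 Bd by (intro cSup_upper bdd_aboveI2[where M = Bd]) (auto simp: frob_norm_eq_norm)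
    ultimately have "0 < Sup ((\<lambda>\<theta>. frob_norm (\<Psi> \<theta>)) ` \<Theta>)"
      by (meson less_le_trans zero_less_norm_iff)
    then show ?thesis
      using ab(1) unfolding \<sigma>F_def \<Psi>_def by simp
  qed
  have "\<sigma>2 \<ge> 0"
  proof -
    have "spec_norm (\<Psi> \<theta>) \<le> real CARD('m) * real CARD('m) * Bd" if "\<theta> \<in> \<Theta>" for \<theta>
      unfolding spec_norm_def using entry[OF that] by (rule onorm_le_matrix_component)
    then have "spec_norm (\<Psi> \<theta>0) \<le> Sup ((\<lambda>\<theta>. spec_norm (\<Psi> \<theta>)) ` \<Theta>)"
      using \<theta>0 by (intro cSup_upper bdd_aboveI2) auto
    then show ?thesis
      using ab(1) spec_norm_nonneg[of "\<Psi> \<theta>0"] unfolding \<sigma>2_def \<Psi>_def by simp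
  qed
  have \<delta>s1: "\<delta>s t < 1" for t
    using sum_le_suminf[of \<delta>s "{t}"] dels by (auto simp: sums_iff less_imp_le intro: le_less_trans)
  have "0 \<le> \<delta>"
    using suminf_nonneg[of \<delta>s] dels by (auto simp: sums_iff less_imp_le)
  \<comment> \<open>This accuracy gives N s^2 / 2 = N \<epsilon>^2 / (32 \<sigma>F^2), matching the
    leading term of the sample-size condition, and it is proportional to
    \<open>\<epsilon> t\<close>, hence summable.\<close>
  define s where "s t = \<epsilon> t / (4 * \<sigma>F)" for t
  have s: "0 < s t" for t
    using eps(1) \<open>\<sigma>F > 0\<close> by (simp add: s_def)
  have lnpos: "0 < ln (2 / \<delta>s t)" for t
    using \<delta>s1[of t] dels(1) by (intro ln_gt_zero) (simp add: field_simps order_less_imp_le less_trans)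
  \<comment> \<open>Bounding \<open>\<gamma> t\<close> below by 1 and
    \<open>\<epsilon> t * \<sigma>2\<close> below by 0 leaves N \<ge> 32 \<sigma>F^2 / \<epsilon>^2
    * ln (2 / \<delta>s), which makes the Hoeffding tail at most
    \<open>\<delta>s t / 2\<close>.\<close>
  have Ns: "ln (2 / \<delta>s t) \<le> real (N t) * (s t)\<^sup>2 / 2" for t
  proof -
    have "\<epsilon> t > 0" "\<delta>s t > 0"
      using eps dels by auto
    have "\<gamma> t \<ge> 1"
      by (simp add: \<gamma>_def)
    then have "ln (2 / \<delta>s t) \<le> ln (2 * \<gamma> t / \<delta>s t)"
      using \<open>\<delta>s t > 0\<close> by (simp add: divide_right_mono)
    moreover have "32 * \<sigma>F\<^sup>2 / (\<epsilon> t)\<^sup>2 \<le> 16 * (2 * \<sigma>F\<^sup>2 + \<epsilon> t * \<sigma>2) / (\<epsilon> t)\<^sup>2"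
      using \<open>\<sigma>2 \<ge> 0\<close> \<open>\<epsilon> t > 0\<close> by (intro divide_right_mono) auto
    ultimately have "32 * \<sigma>F\<^sup>2 / (\<epsilon> t)\<^sup>2 * ln (2 / \<delta>s t)
        \<le> 16 * (2 * \<sigma>F\<^sup>2 + \<epsilon> t * \<sigma>2) / (\<epsilon> t)\<^sup>2 * ln (2 * \<gamma> t / \<delta>s t)"
      using lnpos[of t] \<open>\<sigma>2 \<ge> 0\<close> \<open>\<epsilon> t > 0\<close> by (intro mult_mono) auto
    also have "\<dots> \<le> real (N t)"
      using Nt by blast
    finally show ?thesis
      using \<open>\<epsilon> t > 0\<close> \<open>\<sigma>F > 0\<close> by (simp add: s_def field_simps)
  qed
  have Npos: "0 < N t" for t
    using Ns[of t] lnpos[of t] by (cases "N t") auto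
  have tail: "exp (- (real (N t) * (s t)\<^sup>2 / 2)) \<le> \<delta>s t / 2" for t
  proof -
    have "exp (- (real (N t) * (s t)\<^sup>2 / 2)) \<le> exp (- ln (2 / \<delta>s t))"
      using Ns by simp
    also have "\<dots> = \<delta>s t / 2"
      using dels(1) by (simp add: exp_minus)
    finally show ?thesis .
  qed
  have "summable (\<lambda>t. exp (- (real (N t) * (s t)\<^sup>2 / 2)))"
  proof (rule summable_comparison_test')
    show "summable (\<lambda>t. \<delta>s t / 2)"
      using dels(2) by (intro summable_divide) (auto simp: sums_iff)
  qed (use tail in auto)
  then have "AE \<omega> in M. eventually (\<lambda>t. \<forall>a b.
      \<bar>(1 / real (N t)) * (\<Sum>i<N t. W t i \<omega> $ a * W t i \<omega> $ b) - (if a = b then 1 else 0)\<bar> \<le> s t) sequentially"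
    using rademacher_indep rademacher_dist Npos s
    by (intro AE_eventually_rademacher_second_moment) auto
  then obtain E where E: "E \<in> sets M" "prob E = 1"
    and moment: "\<And>\<omega>. \<omega> \<in> E \<Longrightarrow> eventually (\<lambda>t. \<forall>a b.
      \<bar>(1 / real (N t)) * (\<Sum>i<N t. W t i \<omega> $ a * W t i \<omega> $ b) - (if a = b then 1 else 0)\<bar> \<le> s t) sequentially"
    by (rule AE_E_prob) blast
  \<comment> \<open>The entrywise trace error: m^3 terms, entries of the inverse at most 1 /
    \<alpha>, entries of \<Psi> at most \<open>Bd\<close>, moment error \<open>s t\<close>.\<close>
  define e where "e t = real CARD('m) ^ 3 * (1 / \<alpha> * Bd * s t)" for t
  \<comment> \<open>The gap coefficient of the surrogate combined with the Lipschitz bound for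
    \<Psi>.\<close>
  define C where "C = real CARD('m) / (2 * \<alpha>\<^sup>2) * L\<Psi>\<^sup>2"
  have "summable e"
    unfolding e_def s_def using eps(2) by (intro summable_mult summable_divide)
  have "0 \<le> blinfun_apply (F' z) (y - z)"
    if \<omega>: "\<omega> \<in> E" and sub: "strict_mono k" "(\<lambda>n. \<theta>hat (k n) \<omega>) \<longlonglongrightarrow> z" and y: "y \<in> \<Theta>" for \<omega> k z y
  proof -
    have sp: "\<omega> \<in> space M"
      using E(1) \<omega> sets.sets_into_space by blast
    have iter: "\<theta>hat t \<omega> \<in> \<Theta>" for t
      using iter_in sp by blast
    obtain T where T: "\<And>t a b. T \<le> t \<Longrightarrow>
      \<bar>(1 / real (N t)) * (\<Sum>i<N t. W t i \<omega> $ a * W t i \<omega> $ b) - (if a = b then 1 else 0)\<bar> \<le> s t"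
      using moment[OF \<omega>] unfolding eventually_sequentially by blast
    \<comment> \<open>One threshold \<open>T\<close> serves all \<open>x\<close> and
      \<open>u\<close> at once. This allows \<open>u\<close> to be the next iterate, which depends
      on the same probe vectors.\<close>
    have err: "\<bar>(1 / real (N t)) * (\<Sum>i<N t. (matrix_inv (\<Psi> x) *v W t i \<omega>) \<bullet> (\<Psi> u *v W t i \<omega>))
        - trace (matrix_inv (\<Psi> x) ** \<Psi> u)\<bar> \<le> e t"
      if "T \<le> t" "x \<in> \<Theta>" "u \<in> \<Theta>" for t x u
    proof -
      note inv = matrix_inv_transpose[OF sym[OF that(2)] ab(1) low[OF that(2)]]
      have "\<bar>matrix_inv (\<Psi> x) $ a $ b\<bar> \<le> 1 / \<alpha>" for a b
        using matrix_component_le_onorm[of "matrix_inv (\<Psi> x)" a b]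
          spec_norm_matrix_inv_le[OF ab(1) low[OF that(2)]] by (simp add: spec_norm_def)
      from trace_estimate_error_le[OF T[OF that(1)] this entry[OF that(3)]] show ?thesis
        by (simp add: inv e_def)
    qed
    \<comment> \<open>Minimality compares surrogate values only. Passing from \<open>F\<close> to
      the surrogate at the new iterate and back at \<open>u\<close> costs half of \<open>e t\<close>
      each time.\<close>
    have step: "F (\<theta>hat (Suc t) \<omega>) \<le> F u + C * (norm (u - \<theta>hat t \<omega>))\<^sup>2 + e t"
      if t: "T \<le> t" and u: "u \<in> \<Theta>" for t u
    proof -
      let ?x = "\<theta>hat t \<omega>" and ?x' = "\<theta>hat (Suc t) \<omega>"
      let ?G = "Ghat pr A Q R mu b (N t) (\<lambda>i. W t i \<omega>) ?x"
      \<comment> \<open>With the current iterate as base point, the remaining premises reduce to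
        feasibility of the second point.\<close>
      note bounds = Ghat_Fobj_bounds[OF _ _ ab(1), of A Q R ?x, folded \<Psi>_def,
          OF sym[OF iter] sym _ _ err[OF t iter], OF _ low[OF iter] low]
      have "F ?x' \<le> ?G ?x' + e t / 2"
        unfolding F_def by (rule bounds(1)) (rule iter)+
      also have "?G ?x' \<le> ?G u"
        using iter_argmin sp u by blast
      also have "?G u \<le> F u + real CARD('m) / (2 * \<alpha>\<^sup>2) * (spec_norm (\<Psi> u - \<Psi> ?x))\<^sup>2 + e t / 2"
        unfolding F_def by (rule bounds(2)) (rule u)+
      also have "real CARD('m) / (2 * \<alpha>\<^sup>2) * (spec_norm (\<Psi> u - \<Psi> ?x))\<^sup>2
          \<le> real CARD('m) / (2 * \<alpha>\<^sup>2) * (L\<Psi> * norm (u - ?x))\<^sup>2"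
        using Psi_lip u iter by (intro mult_left_mono power_mono spec_norm_nonneg) auto
      finally show ?thesis
        by (simp add: C_def power_mult_distrib algebra_simps)
    qed
    show ?thesis
    proof (rule accumulation_point_stationary[OF Theta(1,2) _ iter \<open>summable e\<close> step sub y])
      show "(F has_derivative blinfun_apply (F' u)) (at u)" if "u \<in> \<Theta>" for u
        using F_C1 that by blast
    qed
  qed
  \<comment> \<open>The event has full probability, so the claimed bound follows from \<delta> \<ge>
    0.\<close>
  moreover have "1 - \<delta> \<le> prob E"
    using E(2) \<open>0 \<le> \<delta>\<close> by simp
  ultimately show ?thesis
    using E(1) by blast
qed

end
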